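(* Let $l$ be an odd positive integer, let $k\ge1$ and $m\ge0$ be integers, and let $x\in\mathbb{Z}_p$. Then $$E_{m,q}^{(0,k)}(x)=\frac{[l]_q^m}{[l]_{-q}^k}\sum_{i_1,\dots,i_k=0}^{l-1}q^{-\sum_{j=2}^k(j-1)i_j}(-1)^{\sum_{j=1}^k i_j}E_{m,q^l}^{(0,k)}\Big(\frac{x+i_1+\cdots+i_k}{l}\Big).$$ Moreover, $$E_{m,q}^{(0,k)}(lx)=\frac{[l]_q^m}{[l]_{-q}^k}\sum_{i_1,\dots,i_k=0}^{l-1}q^{-\sum_{j=2}^k(j-1)i_j}(-1)^{\sum_{j=1}^k i_j}E_{m,q^l}^{(0,k)}\Big(x+\frac{i_1+\cdots+i_k}{l}\Big).$$
   Context: Let $p$ be an odd prime, $\mathbb{C}_p$ the completion of the algebraic closure of $\mathbb{Q}_p$, with $|p|_p=p^{-1}$. For $Q\in\mathbb{C}_p$ with $|1-Q|_p<p^{-1/(p-1)}$ (this holds for $Q=q$ and $Q=q^l$ below) and $x\in\mathbb{Z}_p$ put $Q^x=\exp(x\log Q)$ and $[x]_Q=\frac{1-Q^x}{1-Q}$; $[2]_Q=1+Q$, and $[l]_{-q}=\frac{1-(-q)^l}{1+q}$. Fix $q\in\mathbb{C}_p$ with $|1-q|_p<p^{-1/(p-1)}$. For $f:\mathbb{Z}_p\to\mathbb{C}_p$ (uniformly differentiable) define $$\int_{\mathbb{Z}_p}f(x)\,d\mu_{-Q}(x)=\lim_{N\to\infty}\frac{[2]_Q}{1+Q^{p^N}}\sum_{x=0}^{p^N-1}f(x)(-1)^xQ^x;$$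 multiple integrals are iterated. For $k\ge1$, $m\ge0$ define $$E_{m,Q}^{(0,k)}(y)=\int_{\mathbb{Z}_p}\cdots\int_{\mathbb{Z}_p}[y+x_1+\cdots+x_k]_Q^m\,Q^{-\sum_{j=1}^k jx_j}\,d\mu_{-Q}(x_1)\cdots d\mu_{-Q}(x_k).$$ When $Q=q^l$ and the argument $y$ satisfies $ly\in\mathbb{Z}_p$ (as for $y=(x+i_1+\cdots+i_k)/l$), the power $(q^l)^{y+x_1+\cdots+x_k}$ is understood as $q^{ly+l(x_1+\cdots+x_k)}$. *)

theory Defs
  imports
    "HOL-Analysis.Analysis"
    "HOL-Computational_Algebra.Polynomial"
    "HOL-Computational_Algebra.Primes"
    "HOL-Library.FuncSet"
begin

text \<open>
  The field \<open>\<complex>\<^sub>p\<close> is given by a type carrying a field structure of characteristic 0 and a complete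
  metric; its absolute value is the distance from 0.  Inside it, \<open>\<rat>\<^sub>p\<close> is the closure of the
  rationals, and the algebraic closure of \<open>\<rat>\<^sub>p\<close> is the set of all elements that are algebraic over \<open>\<rat>\<^sub>p\<close>.
\<close>

definition pabs :: "'a::{field_char_0, complete_space} \<Rightarrow> real" where
  "pabs z = dist z 0"

definition padic_rats :: "'a::{field_char_0, complete_space} set" where
  "padic_rats = closure \<rat>"

definition padic_ints :: "'a::{field_char_0, complete_space} set" where
  "padic_ints = {z \<in> padic_rats. pabs z \<le> 1}"

definition padic_algebraics :: "'a::{field_char_0, complete_space} set" where
  "padic_algebraics =
     {z. \<exists>P. P \<noteq> 0 \<and> (\<forall>i. coeff P i \<in> padic_rats) \<and> poly P z = 0}"

text \<open>
  The type \<open>'a\<close> is \<open>\<complex>\<^sub>p\<close>: its metric is induced by a non-archimedean absolute value with \<open>\<bar>p\<bar> = 1 / p\<close>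
  (which determines it on the rationals, so that \<open>padic_rats\<close> is \<open>\<rat>\<^sub>p\<close>), the elements algebraic
  over \<open>\<rat>\<^sub>p\<close> form an algebraically closed field, and \<open>'a\<close>, which is complete by its sort, is the completion
  of that field.
\<close>

definition is_padic_complex :: "nat \<Rightarrow> 'a::{field_char_0, complete_space} itself \<Rightarrow> bool"
  where
  "is_padic_complex p _ \<longleftrightarrow>
     prime p \<and>
     (\<forall>x y :: 'a. dist x y = pabs (x - y)) \<and>
     (\<forall>x y :: 'a. pabs (x * y) = pabs x * pabs y) \<and>
     (\<forall>x y :: 'a. pabs (x + y) \<le> max (pabs x) (pabs y)) \<and>
     pabs (of_nat p :: 'a) = 1 / real p \<and>
     (\<forall>P :: 'a poly. degree P > 0 \<and> (\<forall>i. coeff P i \<in> padic_algebraics) \<longrightarrow>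
        (\<exists>z \<in> padic_algebraics. poly P z = 0)) \<and>
     closure (padic_algebraics :: 'a set) = UNIV"

definition padic_exp ::
  "'a::{field_char_0, complete_space} \<Rightarrow> 'a" where
  "padic_exp z = (\<Sum>n. z ^ n / fact n)"

definition padic_log ::
  "'a::{field_char_0, complete_space} \<Rightarrow> 'a" where
  "padic_log Q = (\<Sum>n. (- 1) ^ n * (Q - 1) ^ Suc n / of_nat (Suc n))"

definition padic_pow ::
  "'a::{field_char_0, complete_space} \<Rightarrow> 'a \<Rightarrow> 'a" where
  "padic_pow Q z = padic_exp (z * padic_log Q)"

text \<open>
  \<open>qbracket q l z\<close> is \<open>[z]\<^sub>Q\<close> for \<open>Q = q ^ l\<close>.  It is also used for \<open>z\<close> with \<open>l * z\<close>, but not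
  necessarily \<open>z\<close>, in \<open>\<int>\<^sub>p\<close>; hence \<open>Q\<close> to the power \<open>z\<close> is read as \<open>q\<close> to the power \<open>l * z\<close>.
  At \<open>Q = 1\<close>, where the quotient is 0/0, the bracket has its limit value \<open>z\<close>.
\<close>

definition qbracket ::
  "'a::{field_char_0, complete_space} \<Rightarrow> nat \<Rightarrow> 'a \<Rightarrow> 'a" where
  "qbracket q l z =
     (if q ^ l = 1 then z else (1 - padic_pow q (of_nat l * z)) / (1 - q ^ l))"

definition qbracket_minus ::
  "'a::{field_char_0, complete_space} \<Rightarrow> nat \<Rightarrow> 'a" where
  "qbracket_minus q l = (1 - (- q) ^ l) / (1 + q)"

definition fermionic_integral ::
  "nat \<Rightarrow> 'a::{field_char_0, complete_space} \<Rightarrow> ('a \<Rightarrow> 'a) \<Rightarrow> 'a" where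
  "fermionic_integral p Q f =
     lim (\<lambda>N. (1 + Q) / (1 + Q ^ (p ^ N)) *
                (\<Sum>x<p ^ N. f (of_nat x) * (- 1) ^ x * Q ^ x))"

text \<open>
  \<open>F\<close> is a function of the variables \<open>x 1, \<dots>, x k\<close>.  The integral over \<open>x 1\<close> is the innermost one;
  the value 0 given to the coordinates outside \<open>{1..k}\<close> is immaterial.
\<close>

primrec iterated_fermionic_integral ::
  "nat \<Rightarrow> 'a::{field_char_0, complete_space} \<Rightarrow> nat \<Rightarrow> ((nat \<Rightarrow> 'a) \<Rightarrow> 'a) \<Rightarrow> 'a" where
  "iterated_fermionic_integral p Q 0 F = F (\<lambda>_. 0)"
| "iterated_fermionic_integral p Q (Suc k) F =
     fermionic_integral p Q
       (\<lambda>t. iterated_fermionic_integral p Q k (\<lambda>x. F (x(Suc k := t))))"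

text \<open>
  \<open>qEuler p q l m k y\<close> is the value at \<open>y\<close> of the polynomial \<open>E\<close> of type \<open>(0,k)\<close> and index \<open>m\<close> for
  the base \<open>Q = q ^ l\<close>; the base \<open>q\<close> itself is \<open>l = 1\<close>.  The parameters \<open>q\<close> and \<open>l\<close> are kept apart
  because of the reading of powers of \<open>q ^ l\<close> in \<open>qbracket\<close>.
\<close>

definition qEuler ::
  "nat \<Rightarrow> 'a::{field_char_0, complete_space} \<Rightarrow> nat \<Rightarrow> nat \<Rightarrow> nat \<Rightarrow> 'a \<Rightarrow> 'a" where
  "qEuler p q l m k y =
     iterated_fermionic_integral p (q ^ l) k
       (\<lambda>x. qbracket q l (y + (\<Sum>j=1..k. x j)) ^ m *
             padic_pow (q ^ l) (- (\<Sum>j=1..k. of_nat j * x j)))"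

end

theory Submission
  imports Defs
begin

text \<open>
  Put \<open>Q = q ^ l\<close>.  Integrating out \<open>x\<^sub>j\<close> turns a function \<open>\<phi>\<close> of \<open>n = l * (y + x\<^sub>j + \<dots> + x\<^sub>k) - x\<close> into the solution
  \<open>\<psi>\<close> of \<open>\<psi> n + Q\<^bsup>1-j\<^esup> * \<psi> (n + l) = (1 + Q) * \<phi> n\<close>: with \<open>g t = \<psi> (n + l * t) * Q\<^bsup>-jt\<^esup>\<close> the sums defining the
  integral telescope to \<open>(g 0 + Q ^ M * g M) / (1 + Q ^ M)\<close>, \<open>M = p ^ N\<close>, which tends to \<open>g 0 = \<psi> n\<close>.  Since
  \<open>[x + n]\<^sub>q\<close> is affine in the \<open>q\<close>-integer \<open>[n]\<^sub>q\<close> and \<open>[n + l]\<^sub>q = [l]\<^sub>q + Q * [n]\<^sub>q\<close>, all these functions are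
  polynomials in \<open>[n]\<^sub>q\<close>; this treats \<open>q = 1\<close> and \<open>q \<noteq> 1\<close> alike.

  If \<open>\<psi>\<close> solves the equation with step \<open>l\<close> and base \<open>Q\<close>, then, \<open>l\<close> being odd,
  \<open>(1 + q) / (1 + Q) * (\<Sum>i<l. (-1) ^ i * q\<^bsup>(1-j)i\<^esup> * \<psi> (n + i))\<close> telescopes to a solution with step 1 and base \<open>q\<close>.
  Doing this for every variable gives the theorem.

  That \<open>padic_pow\<close> extends integer powers rests on \<open>exp (log q) = q\<close>.  To see this, let \<open>M = p ^ N\<close>: both
  \<open>exp (log q) ^ M\<close> and \<open>q ^ M\<close> equal \<open>1 + M * log q\<close> up to an error of size \<open>\<bar>M\<bar>\<^sup>2\<close>, while their distance is
  \<open>\<bar>M\<bar> * \<bar>exp (log q) - q\<bar>\<close>.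
\<close>

subsection \<open>An affine functional equation for polynomials\<close>

lemma pcompose_monom:
  fixes e :: "'b::comm_semiring_1"
  shows "pcompose (monom e n) P = smult e (P ^ n)"
  by (induction n) (simp_all add: monom_0 monom_Suc pcompose_pCons)

lemma coeff_pcompose_monom_affine:
  fixes e :: "'b::comm_semiring_1"
  shows "coeff (pcompose (monom e d) [:b, c:]) d = e * c ^ d"
  by (simp add: pcompose_monom coeff_linear_poly_power)

lemma degree_pcompose_affine_le: "degree (pcompose P [:b, c:]) \<le> degree P"
  using degree_pcompose_le[of P "[:b, c:]"] by (simp split: if_splits)

lemma exists_poly_affine_functional_equation:
  fixes a b c :: "'b::field" and R :: "'b poly"
  assumes nonzero: "\<And>r::nat. 1 + a * c ^ r \<noteq> 0"
  shows "\<exists>P. P + smult a (pcompose P [:b, c:]) = R"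
proof (induction "degree R" arbitrary: R rule: less_induct)
  case less
  define d where "d = degree R"
  define T where "T P = P + smult a (pcompose P [:b, c:])" for P
  define P\<^sub>0 where "P\<^sub>0 = monom (lead_coeff R / (1 + a * c ^ d)) d"
  have T_add: "T (P + P') = T P + T P'" for P P'
    by (simp add: T_def pcompose_add smult_add_right)
  have "degree P\<^sub>0 \<le> d"
    by (simp add: P\<^sub>0_def degree_monom_le)
  then have "degree (R - T P\<^sub>0) \<le> d"
    unfolding T_def d_def
    by (intro degree_diff_le degree_add_le order_trans[OF degree_smult_le]
        order_trans[OF degree_pcompose_affine_le]) simp_all
  moreover have "coeff (T P\<^sub>0) d = lead_coeff R / (1 + a * c ^ d) * (1 + a * c ^ d)"
    unfolding T_def P\<^sub>0_def by (simp add: coeff_pcompose_monom_affine distrib_left)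
  then have "coeff (R - T P\<^sub>0) d = 0"
    using nonzero[of d] by (simp add: d_def)
  ultimately consider (exact) "R - T P\<^sub>0 = 0" | (smaller_degree) "degree (R - T P\<^sub>0) < degree R"
    using eq_zero_or_degree_less unfolding d_def by blast
  then have "\<exists>P. T P = R"
  proof cases
    case smaller_degree
    then obtain P where "T P = R - T P\<^sub>0"
      using less unfolding T_def by blast
    then show ?thesis
      by (intro exI[of _ "P + P\<^sub>0"]) (simp add: T_add)
  qed auto
  then show ?case by (simp add: T_def)
qed

subsection \<open>Twisted sums over shifts\<close>

lemma sum_mult_fun_upd_Suc:
  fixes w v :: "nat \<Rightarrow> 'b::comm_semiring_0"
  shows "(\<Sum>j=1..Suc k. w j * (v(Suc k := t)) j) = (\<Sum>j=1..k. w j * v j) + w (Suc k) * t"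
  by (auto intro!: sum.cong)

lemma sum_fun_upd_Suc:
  fixes v :: "nat \<Rightarrow> 'b::comm_semiring_1"
  shows "(\<Sum>j=1..Suc k. (v(Suc k := t)) j) = (\<Sum>j=1..k. v j) + t"
  using sum_mult_fun_upd_Suc[where w = "\<lambda>_. 1" and v = v and k = k and t = t]
  by (simp only: mult_1)

lemma sum_PiE_Suc:
  "(\<Sum>i \<in> {1..Suc k} \<rightarrow>\<^sub>E A. f i) = (\<Sum>t\<in>A. \<Sum>i \<in> {1..k} \<rightarrow>\<^sub>E A. f (i(Suc k := t)))"
proof -
  have "{1..Suc k} \<rightarrow>\<^sub>E A = (\<lambda>(t, i). i(Suc k := t)) ` (A \<times> ({1..k} \<rightarrow>\<^sub>E A))"
    using PiE_insert_eq[of "Suc k" "{1..k}" "\<lambda>_. A"]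
    by (simp only: atLeastAtMostSuc_conv le_add1 plus_1_eq_Suc)
  moreover have "inj_on (\<lambda>(t, i). i(Suc k := t)) (A \<times> ({1..k} \<rightarrow>\<^sub>E A))"
    by (intro inj_combinator) auto
  ultimately show ?thesis
    by (simp add: sum.reindex sum.cartesian_product case_prod_unfold)
qed

definition twist :: "'b::comm_ring_1 \<Rightarrow> nat \<Rightarrow> (nat \<Rightarrow> nat) \<Rightarrow> 'b" where
  "twist u k i = u ^ (\<Sum>j=1..k. (j - 1) * i j) * (- 1) ^ (\<Sum>j=1..k. i j)"

lemma twist_fun_upd_Suc: "twist u (Suc k) (i(Suc k := t)) = (- (u ^ k)) ^ t * twist u k i"
  unfolding twist_def sum_mult_fun_upd_Suc sum_fun_upd_Suc
  by (simp add: power_add power_mult power_minus[of "u ^ k"] mult_ac)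

lemma twist_inverse:
  fixes q :: "'b::field"
  shows "twist (inverse q) k i =
    q powi (- int (\<Sum>j=2..k. (j - 1) * i j)) * (- 1) ^ (\<Sum>j=1..k. i j)"
proof -
  have "(\<Sum>j=1..k. (j - 1) * i j) = (\<Sum>j=2..k. (j - 1) * i j)"
    by (intro sum.mono_neutral_right) auto
  then show ?thesis
    by (simp only: twist_def power_int_minus power_int_of_nat power_inverse)
qed

definition twisted_shift_sum ::
  "'b::comm_ring_1 \<Rightarrow> nat \<Rightarrow> nat \<Rightarrow> (nat \<Rightarrow> 'b) \<Rightarrow> nat \<Rightarrow> 'b" where
  "twisted_shift_sum u l k f n =
     (\<Sum>i \<in> {1..k} \<rightarrow>\<^sub>E {0..<l}. twist u k i * f (n + (\<Sum>j=1..k. i j)))"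

lemma twisted_shift_sum_0: "twisted_shift_sum u l 0 f n = f n"
  by (simp add: twisted_shift_sum_def twist_def)

lemma twisted_shift_sum_add:
  "twisted_shift_sum u l k (\<lambda>n. f n + g n) n =
     twisted_shift_sum u l k f n + twisted_shift_sum u l k g n"
  by (simp add: twisted_shift_sum_def sum.distrib distrib_left)

lemma twisted_shift_sum_mult:
  "twisted_shift_sum u l k (\<lambda>n. c * f n) n = c * twisted_shift_sum u l k f n"
  by (simp add: twisted_shift_sum_def sum_distrib_left mult.left_commute[of c])

lemma twisted_shift_sum_shift:
  "twisted_shift_sum u l k (\<lambda>n. f (n + d)) n = twisted_shift_sum u l k f (n + d)"
  by (simp add: twisted_shift_sum_def add_ac)

lemma twisted_shift_sum_Suc:
  "twisted_shift_sum u l (Suc k) f n =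
     (\<Sum>t<l. (- (u ^ k)) ^ t * twisted_shift_sum u l k f (n + t))"
  unfolding twisted_shift_sum_def sum_PiE_Suc twist_fun_upd_Suc sum_fun_upd_Suc
  by (simp add: sum_distrib_left lessThan_atLeast0 add_ac mult_ac)

lemma twisted_shift_sum_telescope:
  assumes "odd l" and functional_equation: "\<And>n. f n + (u ^ l) ^ k * f (n + l) = c * g n"
  shows "twisted_shift_sum u l (Suc k) f n + u ^ k * twisted_shift_sum u l (Suc k) f (n + 1) =
    c * twisted_shift_sum u l k g n"
proof -
  let ?F = "twisted_shift_sum u l k f"
  have "twisted_shift_sum u l (Suc k) f n + u ^ k * twisted_shift_sum u l (Suc k) f (n + 1)
      = (\<Sum>t<l. (- (u ^ k)) ^ t * ?F (n + t) - (- (u ^ k)) ^ Suc t * ?F (n + Suc t))"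
    by (simp add: twisted_shift_sum_Suc sum.distrib sum_distrib_left mult_ac)
  also have "\<dots> = ?F n - (- (u ^ k)) ^ l * ?F (n + l)"
    by (subst sum_lessThan_telescope') simp
  also have "\<dots> = ?F n + (u ^ l) ^ k * ?F (n + l)"
    using \<open>odd l\<close> by (simp add: mult.commute flip: power_mult)
  also have "\<dots> = twisted_shift_sum u l k (\<lambda>n. f n + (u ^ l) ^ k * f (n + l)) n"
    by (simp only: twisted_shift_sum_add twisted_shift_sum_mult twisted_shift_sum_shift)
  also have "\<dots> = c * twisted_shift_sum u l k g n"
    unfolding functional_equation by (rule twisted_shift_sum_mult)
  finally show ?thesis .
qed

subsection \<open>The \<open>q\<close>-integers\<close>

definition qnat :: "'b::comm_ring_1 \<Rightarrow> nat \<Rightarrow> 'b" where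
  "qnat q n = (\<Sum>i<n. q ^ i)"

lemma qnat_0: "qnat q 0 = 0"
  by (simp add: qnat_def)

lemma qnat_1: "qnat q 1 = 1"
  by (simp add: qnat_def)

lemma qnat_base_1: "qnat 1 n = of_nat n"
  by (simp add: qnat_def)

lemma qnat_add: "qnat q (m + n) = qnat q m + q ^ m * qnat q n"
  by (induction n) (auto simp: qnat_def algebra_simps power_add)

lemma qnat_geometric: "(1 - q) * qnat q n = 1 - q ^ n"
  unfolding qnat_def by (simp add: one_diff_power_eq)

lemma qnat_eq_sum_binomial: "qnat q n = (\<Sum>k<n. of_nat (n choose Suc k) * (q - 1) ^ k)"
proof (induction n)
  case (Suc n)
  have "q ^ n = ((q - 1) + 1) ^ n" by simp
  also have "\<dots> = (\<Sum>k<Suc n. of_nat (n choose k) * (q - 1) ^ k)"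
    unfolding lessThan_Suc_atMost by (subst binomial_ring) simp
  finally show ?case
    using Suc.IH by (simp add: qnat_def binomial_eq_0 sum.distrib algebra_simps)
qed (simp add: qnat_0)

lemma of_nat_binomial_Suc:
  "(of_nat (n choose Suc k) :: 'b::field_char_0) =
     of_nat n * of_nat ((n - 1) choose k) / of_nat (Suc k)"
  using binomial_absorption[of k n]
  by (metis nonzero_mult_div_cancel_left of_nat_eq_0_iff of_nat_mult nat.distinct(1))

lemma qnat_eq_of_nat_times_sum:
  fixes q :: "'b::field_char_0"
  shows "qnat q n = of_nat n * (\<Sum>k<n. of_nat ((n - 1) choose k) * (q - 1) ^ k / of_nat (Suc k))"
  by (simp add: qnat_eq_sum_binomial of_nat_binomial_Suc sum_distrib_left mult.assoc
      del: of_nat_Suc)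

subsection \<open>Ultrametric fields\<close>

lemma pabs_nonneg [simp]: "pabs x \<ge> 0"
  by (simp add: pabs_def)

lemma pabs_0 [simp]: "pabs 0 = 0"
  by (simp add: pabs_def)

lemma pabs_eq_0_iff [simp]: "pabs x = 0 \<longleftrightarrow> x = 0"
  by (simp add: pabs_def)

lemma pabs_le_0_iff [simp]: "pabs x \<le> 0 \<longleftrightarrow> x = 0"
  by (simp add: pabs_def)

lemma pabs_pos_iff [simp]: "pabs x > 0 \<longleftrightarrow> x \<noteq> 0"
  by (simp add: pabs_def)

locale ultrametric_field =
  fixes ty :: "'a::{field_char_0, complete_space} itself"
  assumes dist_eq_pabs: "dist (x :: 'a) y = pabs (x - y)"
    and pabs_mult: "pabs (x * y :: 'a) = pabs x * pabs y"
    and pabs_add_le_max: "pabs (x + y :: 'a) \<le> max (pabs x) (pabs y)"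
begin

lemma pabs_1 [simp]: "pabs (1 :: 'a) = 1"
  using pabs_mult[of 1 1] pabs_eq_0_iff[of "1 :: 'a"] by auto

lemma pabs_power: "pabs (x ^ n :: 'a) = pabs x ^ n"
  by (induction n) (auto simp: pabs_mult)

lemma pabs_inverse: "pabs (inverse x :: 'a) = inverse (pabs x)"
  using pabs_mult[of x "inverse x"] by (cases "x = 0") (auto simp: field_simps)

lemma pabs_divide: "pabs (x / y :: 'a) = pabs x / pabs y"
  by (simp add: divide_inverse pabs_mult pabs_inverse)

lemma pabs_minus_commute: "pabs (x - y :: 'a) = pabs (y - x)"
  using dist_eq_pabs[of x y] dist_eq_pabs[of y x] by (simp add: dist_commute)

lemma pabs_minus [simp]: "pabs (- x :: 'a) = pabs x"
  using pabs_minus_commute[of 0 x] by simp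

lemma pabs_add_le: "pabs (x :: 'a) \<le> c \<Longrightarrow> pabs y \<le> c \<Longrightarrow> pabs (x + y) \<le> c"
  using pabs_add_le_max[of x y] by linarith

lemma pabs_add_less: "pabs (x :: 'a) < c \<Longrightarrow> pabs y < c \<Longrightarrow> pabs (x + y) < c"
  using pabs_add_le_max[of x y] by linarith

lemma pabs_diff_le: "pabs (x :: 'a) \<le> c \<Longrightarrow> pabs y \<le> c \<Longrightarrow> pabs (x - y) \<le> c"
  using pabs_add_le[of x c "- y"] by simp

lemma pabs_sum_le:
  fixes f :: "'b \<Rightarrow> 'a"
  shows "(\<And>i. i \<in> A \<Longrightarrow> pabs (f i) \<le> c) \<Longrightarrow> c \<ge> 0 \<Longrightarrow> pabs (sum f A) \<le> c"
  by (induction A rule: infinite_finite_induct) (auto intro: pabs_add_le)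

lemma pabs_eq_if_close: "pabs (x - y :: 'a) < pabs y \<Longrightarrow> pabs x = pabs y"
  using pabs_add_le_max[of "x - y" y] pabs_add_le_max[of "y - x" x]
  by (simp add: pabs_minus_commute[of y x])

lemma pabs_mult_le: "pabs (x :: 'a) \<le> 1 \<Longrightarrow> pabs (x * y) \<le> pabs y"
  by (simp add: pabs_mult mult_left_le_one_le)

lemma pabs_of_nat_le_1 [simp]: "pabs (of_nat n :: 'a) \<le> 1"
  by (induction n) (auto intro: pabs_add_le)

lemma pabs_of_nat_mult_less: "pabs (z :: 'a) < c \<Longrightarrow> pabs (of_nat n * z) < c"
  using pabs_mult_le[of "of_nat n" z] by simp

lemma tendsto_iff_pabs:
  "((f :: 'b \<Rightarrow> 'a) \<longlongrightarrow> L) F \<longleftrightarrow> ((\<lambda>x. pabs (f x - L)) \<longlongrightarrow> 0) F"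
  by (subst tendsto_dist_iff) (simp add: dist_eq_pabs)

lemma tendsto_if_pabs_le:
  fixes f :: "'b \<Rightarrow> 'a"
  assumes "\<And>x. pabs (f x - L) \<le> g x" "(g \<longlongrightarrow> 0) F"
  shows "(f \<longlongrightarrow> L) F"
  unfolding tendsto_iff_pabs
  by (rule tendsto_sandwich[OF _ _ tendsto_const assms(2)]) (simp_all add: assms(1))

lemma ultrametric_tendsto_add:
  fixes f g :: "'b \<Rightarrow> 'a"
  assumes "(f \<longlongrightarrow> x) F" "(g \<longlongrightarrow> y) F"
  shows "((\<lambda>n. f n + g n) \<longlongrightarrow> x + y) F"
proof (rule tendsto_if_pabs_le)
  show "pabs (f n + g n - (x + y)) \<le> pabs (f n - x) + pabs (g n - y)" for n
    using pabs_add_le[of "f n - x" "pabs (f n - x) + pabs (g n - y)" "g n - y"]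
    by (simp add: algebra_simps)
  show "((\<lambda>n. pabs (f n - x) + pabs (g n - y)) \<longlongrightarrow> 0) F"
    using assms unfolding tendsto_iff_pabs by (rule tendsto_add_zero)
qed

lemma ultrametric_tendsto_mult_left:
  fixes f :: "'b \<Rightarrow> 'a"
  assumes "(f \<longlongrightarrow> x) F"
  shows "((\<lambda>n. c * f n) \<longlongrightarrow> c * x) F"
proof (rule tendsto_if_pabs_le)
  show "pabs (c * f n - c * x) \<le> pabs c * pabs (f n - x)" for n
    by (simp add: pabs_mult flip: right_diff_distrib)
  show "((\<lambda>n. pabs c * pabs (f n - x)) \<longlongrightarrow> 0) F"
    using assms unfolding tendsto_iff_pabs by (rule tendsto_mult_right_zero)
qed

lemma ultrametric_tendsto_mult:
  fixes f g :: "'b \<Rightarrow> 'a"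
  assumes "(f \<longlongrightarrow> x) F" "(g \<longlongrightarrow> y) F"
  shows "((\<lambda>n. f n * g n) \<longlongrightarrow> x * y) F"
proof -
  have "((\<lambda>n. (f n - x) * (g n - y)) \<longlongrightarrow> 0) F"
    using tendsto_mult_zero[OF assms[unfolded tendsto_iff_pabs]]
    by (simp add: tendsto_iff_pabs[of _ 0] pabs_mult)
  then have "((\<lambda>n. (f n - x) * (g n - y) + (y * f n + x * g n) + - (x * y))
      \<longlongrightarrow> 0 + (y * x + x * y) + - (x * y)) F"
    by (intro ultrametric_tendsto_add ultrametric_tendsto_mult_left tendsto_const assms)
  then show ?thesis by (simp add: algebra_simps)
qed

lemma summable_if_tendsto_0:
  fixes f :: "nat \<Rightarrow> 'a"
  assumes "f \<longlonglongrightarrow> 0"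
  shows "summable f"
  unfolding summable_iff_convergent
proof (intro Cauchy_convergent metric_CauchyI)
  fix e :: real assume "e > 0"
  then obtain M where term_less: "pabs (f n) < e / 2" if "n \<ge> M" for n
    using LIMSEQ_D[of "\<lambda>n. pabs (f n)" 0 "e / 2"] assms by (auto simp: tendsto_iff_pabs[of f])
  have tail_le: "pabs (sum f {..<n} - sum f {..<M}) \<le> e / 2" if "n \<ge> M" for n
  proof -
    have "sum f {..<n} - sum f {..<M} = sum f {M..<n}"
      using that sum_diff_nat_ivl[of 0 M n f] by (simp add: lessThan_atLeast0)
    also have "pabs \<dots> \<le> e / 2"
      using \<open>e > 0\<close> by (intro pabs_sum_le less_imp_le[OF term_less]) auto
    finally show ?thesis .
  qed
  have "dist (sum f {..<m}) (sum f {..<n}) < e" if "m \<ge> M" "n \<ge> M" for m n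
    using pabs_diff_le[OF tail_le[OF that(1)] tail_le[OF that(2)]] \<open>e > 0\<close>
    by (simp add: dist_eq_pabs)
  then show "\<exists>M. \<forall>m\<ge>M. \<forall>n\<ge>M. dist (sum f {..<m}) (sum f {..<n}) < e" by blast
qed

lemma pabs_sums_diff_le:
  fixes f g :: "nat \<Rightarrow> 'a"
  assumes "f sums a" "g sums b" and diff_le: "\<And>n. pabs (f n - g n) \<le> c"
  shows "pabs (a - b) \<le> c"
proof -
  have "c \<ge> 0"
    using diff_le[of 0] pabs_nonneg order_trans by blast
  then have "dist (sum f {..<N}) (sum g {..<N}) \<le> c" for N
    unfolding dist_eq_pabs sum_subtractf[symmetric] by (intro pabs_sum_le diff_le)
  then have "dist a b \<le> c"
    using assms(1,2) unfolding sums_def by (intro LIMSEQ_le_const2[OF tendsto_dist]) auto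
  then show ?thesis by (simp add: dist_eq_pabs)
qed

lemma pabs_sums_minus_partial_sum_le:
  fixes f :: "nat \<Rightarrow> 'a"
  assumes "f sums a" and term_le: "\<And>n. n \<ge> m \<Longrightarrow> pabs (f n) \<le> c"
  shows "pabs (a - sum f {..<m}) \<le> c"
proof (rule pabs_sums_diff_le[OF assms(1) sums_If_finite_set])
  show "pabs (f n - (if n \<in> {..<m} then f n else 0)) \<le> c" for n
    using term_le[of n] term_le[of m] by (auto intro: order_trans[OF pabs_nonneg])
qed simp

lemma sums_imp_tendsto_0:
  fixes f :: "nat \<Rightarrow> 'a"
  assumes "f sums a"
  shows "f \<longlonglongrightarrow> 0"
proof -
  have "(\<lambda>n. sum f {..<Suc n} + - 1 * sum f {..<n}) \<longlonglongrightarrow> a + - 1 * a"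
    using assms unfolding sums_def
    by (intro ultrametric_tendsto_add ultrametric_tendsto_mult_left
        LIMSEQ_Suc[of "\<lambda>n. sum f {..<n}"])
  then show ?thesis by simp
qed

lemma pabs_product_minus_Cauchy_product_le:
  fixes a b :: "nat \<Rightarrow> 'a"
  assumes "\<And>n. pabs (a n) \<le> K" "\<And>n. pabs (b n) \<le> K"
    and "\<And>n. n \<ge> M \<Longrightarrow> pabs (a n) \<le> e" "\<And>n. n \<ge> M \<Longrightarrow> pabs (b n) \<le> e"
    and "N \<ge> 2 * M"
  shows "pabs ((\<Sum>n<N. a n) * (\<Sum>n<N. b n) - (\<Sum>n<N. \<Sum>i\<le>n. a i * b (n - i))) \<le> K * e"
proof -
  let ?T = "{(i, j). i + j < N}" and ?S = "{..<N} \<times> {..<N}"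
  have nonneg: "K \<ge> 0" "e \<ge> 0"
    using assms(1)[of 0] assms(3)[OF order_refl] pabs_nonneg order_trans by blast+
  have "?T \<subseteq> ?S" by auto
  then have "(\<Sum>n<N. a n) * (\<Sum>n<N. b n) - (\<Sum>n<N. \<Sum>i\<le>n. a i * b (n - i))
      = (\<Sum>(i,j)\<in>?S - ?T. a i * b j)"
    by (simp add: sum_product sum.cartesian_product sum_diff
        flip: sum.triangle_reindex[of "\<lambda>i j. a i * b j"])
  also have "pabs \<dots> \<le> K * e"
  proof (rule pabs_sum_le)
    fix x assume "x \<in> ?S - ?T"
    then obtain i j where x_eq: "x = (i, j)" and "i + j \<ge> N"
      by (cases x) auto
    then consider (i_large) "i \<ge> M" | (j_large) "j \<ge> M"
      using assms(5) by linarith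
    then have "pabs (a i * b j) \<le> K * e"
    proof cases
      case i_large
      then have "pabs (a i) * pabs (b j) \<le> e * K"
        using assms(2,3) nonneg by (intro mult_mono) auto
      then show ?thesis by (simp add: pabs_mult mult.commute)
    next
      case j_large
      then show ?thesis
        unfolding pabs_mult using assms(1,4) nonneg by (intro mult_mono) auto
    qed
    then show "pabs (case x of (i, j) \<Rightarrow> a i * b j) \<le> K * e"
      by (simp add: x_eq)
  qed (use nonneg in simp)
  finally show ?thesis .
qed

lemma Cauchy_product_sums_ultrametric:
  fixes a b :: "nat \<Rightarrow> 'a"
  assumes "a sums A" "b sums B"
  shows "(\<lambda>n. \<Sum>i\<le>n. a i * b (n - i)) sums (A * B)"
proof -
  let ?D = "\<lambda>N. (\<Sum>n<N. a n) * (\<Sum>n<N. b n) - (\<Sum>n<N. \<Sum>i\<le>n. a i * b (n - i))"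
  have terms_tendsto_0: "a \<longlonglongrightarrow> 0" "b \<longlonglongrightarrow> 0"
    using assms by (simp_all add: sums_imp_tendsto_0)
  then have "bounded (range a \<union> range b)"
    by (simp add: convergent_imp_bounded)
  then obtain K where "\<forall>y \<in> range a \<union> range b. dist 0 y \<le> K"
    using bounded_any_center[of _ 0] by blast
  then have bound: "pabs (a n) \<le> K" "pabs (b n) \<le> K" for n
    unfolding pabs_def dist_commute[of _ 0] by blast+
  have "?D \<longlonglongrightarrow> 0"
  proof (rule metric_LIMSEQ_I)
    fix r :: real assume "r > 0"
    define e where "e = r / (K + 1)"
    have "K \<ge> 0" using bound(1)[of 0] pabs_nonneg order_trans by blast
    then have e_small: "e > 0" "K * e < r"
      using \<open>r > 0\<close> by (auto simp: e_def field_simps)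
    have "\<forall>\<^sub>F n in sequentially. pabs (a n) < e \<and> pabs (b n) < e"
      using terms_tendsto_0 e_small(1) by (simp add: tendsto_iff pabs_def eventually_conj)
    then obtain M where tail_le: "pabs (a n) \<le> e" "pabs (b n) \<le> e" if "n \<ge> M" for n
      unfolding eventually_sequentially by (meson less_imp_le)
    have "dist (?D N) 0 < r" if "N \<ge> 2 * M" for N
      using le_less_trans[OF pabs_product_minus_Cauchy_product_le[OF bound tail_le that] e_small(2)]
      by (simp only: pabs_def)
    then show "\<exists>M. \<forall>N\<ge>M. dist (?D N) 0 < r" by blast
  qed
  then have "(\<lambda>N. - 1 * ?D N) \<longlonglongrightarrow> - 1 * 0"
    by (rule ultrametric_tendsto_mult_left)
  from ultrametric_tendsto_add[OF this ultrametric_tendsto_mult[OF assms[unfolded sums_def]]]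
  show ?thesis by (simp add: sums_def)
qed

end

subsection \<open>The \<open>p\<close>-adic exponential and logarithm\<close>

locale padic_field = ultrametric_field ty
  for ty :: "'a::{field_char_0, complete_space} itself" +
  fixes p :: nat
  assumes prime_p: "prime p"
    and pabs_p: "pabs (of_nat p :: 'a) = 1 / real p"
begin

lemma p_gt_1: "p > 1"
  using prime_p by (rule prime_gt_1_nat)

lemma pabs_p_less_1: "pabs (of_nat p :: 'a) < 1"
  using p_gt_1 by (simp add: pabs_p)

lemma pabs_p_power_tendsto_0: "(\<lambda>N. pabs (of_nat (p ^ N) :: 'a)) \<longlonglongrightarrow> 0"
  using pabs_p_less_1 by (simp add: pabs_power LIMSEQ_power_zero)

lemma pabs_of_nat_not_dvd:
  assumes "\<not> p dvd n"
  shows "pabs (of_nat n :: 'a) = 1"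
proof -
  have "gcd n p = 1"
    using assms prime_p by (metis coprime_commute coprime_imp_gcd_eq_1 prime_imp_coprime)
  moreover have "n \<noteq> 0" using assms by (metis dvd_0_right)
  ultimately obtain x y where bezout: "n * x = p * y + 1"
    using bezout_nat[of n p] by auto
  have "of_nat n * of_nat x - 1 = (of_nat y * of_nat p :: 'a)"
    using arg_cong[OF bezout, of "of_nat :: nat \<Rightarrow> 'a"] by (simp add: mult.commute)
  moreover have "pabs (of_nat y * of_nat p :: 'a) < 1"
    using pabs_mult_le[OF pabs_of_nat_le_1] pabs_p_less_1 by (rule le_less_trans)
  ultimately have "pabs (of_nat n * of_nat x :: 'a) = 1"
    using pabs_eq_if_close[of _ 1] by simp
  then show ?thesis
    using mult_left_le_one_le[of "pabs (of_nat n :: 'a)" "pabs (of_nat x :: 'a)"]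
    by (simp add: pabs_mult antisym mult.commute)
qed

definition exp_radius :: real where
  "exp_radius = real p powr (- 1 / (real p - 1))"

lemma exp_radius_pos: "exp_radius > 0"
  using p_gt_1 by (simp add: exp_radius_def)

lemma exp_radius_less_1: "exp_radius < 1"
  unfolding exp_radius_def using p_gt_1 by (intro powr_less_one) (auto simp: field_simps)

lemma exp_radius_power: "exp_radius ^ (p - 1) = 1 / real p"
proof -
  have "exp_radius ^ (p - 1) = real p powr (- 1 / (real p - 1) * real (p - 1))"
    using p_gt_1 by (simp add: exp_radius_def powr_powr flip: powr_realpow)
  also have "\<dots> = real p powr (- 1)"
    using p_gt_1 by (simp add: of_nat_diff)
  finally show ?thesis
    using p_gt_1 by (simp add: powr_minus_divide)
qed

lemma pabs_fact: "pabs (fact n :: 'a) = (1 / real p) ^ (n div p) * pabs (fact (n div p) :: 'a)"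
proof (induction n)
  case (Suc n)
  have fact_Suc: "pabs (fact (Suc m) :: 'a) = pabs (of_nat (Suc m) :: 'a) * pabs (fact m :: 'a)"
    for m
    by (simp add: pabs_mult del: of_nat_Suc)
  show ?case
  proof (cases "p dvd Suc n")
    case True
    then have div_Suc_eq: "Suc n div p = Suc (n div p)"
      by (simp add: div_Suc dvd_eq_mod_eq_0)
    then have "Suc n = p * Suc (n div p)"
      using True by (metis dvd_mult_div_cancel)
    then have "pabs (of_nat (Suc n) :: 'a) = 1 / real p * pabs (of_nat (Suc (n div p)) :: 'a)"
      by (metis of_nat_mult pabs_mult pabs_p)
    then show ?thesis
      unfolding div_Suc_eq fact_Suc Suc.IH by simp
  next
    case False
    then have "Suc n div p = n div p"
      by (simp add: div_Suc dvd_eq_mod_eq_0)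
    then show ?thesis
      unfolding fact_Suc Suc.IH pabs_of_nat_not_dvd[OF False] by simp
  qed
qed simp

lemma pabs_fact_ge: "n > 0 \<Longrightarrow> pabs (fact n :: 'a) \<ge> exp_radius ^ (n - 1)"
proof (induction n rule: less_induct)
  case (less n)
  show ?case
  proof (cases "n div p = 0")
    case True
    then show ?thesis
      using exp_radius_pos exp_radius_less_1 by (simp add: pabs_fact[of n] power_le_one)
  next
    case False
    let ?m = "n div p"
    have quotient_range: "0 < ?m" "?m < n"
      using False p_gt_1 less.prems by auto
    have "?m * p \<le> n" by simp
    then have "(p - 1) * ?m + (?m - 1) \<le> n - 1"
      using quotient_range p_gt_1 by (cases p; simp add: algebra_simps)
    then have "exp_radius ^ (n - 1) \<le> exp_radius ^ ((p - 1) * ?m + (?m - 1))"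
      using exp_radius_pos exp_radius_less_1 by (intro power_decreasing) auto
    also have "\<dots> = (1 / real p) ^ ?m * exp_radius ^ (?m - 1)"
      by (simp only: power_add power_mult exp_radius_power)
    also have "\<dots> \<le> (1 / real p) ^ ?m * pabs (fact ?m :: 'a)"
      using less.IH[OF quotient_range(2) quotient_range(1)] by (intro mult_left_mono) auto
    finally show ?thesis by (simp add: pabs_fact[of n])
  qed
qed

lemma pabs_power_divide_fact_le: "pabs (z ^ n / fact (Suc n) :: 'a) \<le> (pabs z / exp_radius) ^ n"
  using pabs_fact_ge[of "Suc n"] exp_radius_pos
  by (auto simp: pabs_divide pabs_power power_divide simp del: fact_Suc intro!: divide_left_mono)

lemma pabs_divide_of_nat_le: "pabs (z / of_nat (Suc n) :: 'a) \<le> pabs (z / fact (Suc n))"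
proof -
  have "z / of_nat (Suc n) = of_nat (fact n) * (z / fact (Suc n))"
    by simp
  then show ?thesis
    by (metis pabs_mult_le pabs_of_nat_le_1)
qed

lemma pabs_power_divide_of_nat_le: "pabs (z ^ n / of_nat (Suc n) :: 'a) \<le> (pabs z / exp_radius) ^ n"
  by (rule order_trans[OF pabs_divide_of_nat_le pabs_power_divide_fact_le])

lemma ratio_power_le_1: "pabs (z :: 'a) < exp_radius \<Longrightarrow> (pabs z / exp_radius) ^ n \<le> 1"
  using exp_radius_pos by (intro power_le_one) auto

lemma tendsto_0_if_ratio_bound:
  fixes f :: "nat \<Rightarrow> 'a"
  assumes "pabs (z :: 'a) < exp_radius"
    and "\<And>n. pabs (f n) \<le> pabs z * (pabs z / exp_radius) ^ n"
  shows "f \<longlonglongrightarrow> 0"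
proof (rule tendsto_if_pabs_le)
  show "pabs (f n - 0) \<le> pabs z * (pabs z / exp_radius) ^ n" for n
    using assms(2) by (simp only: diff_0_right)
  show "(\<lambda>n. pabs z * (pabs z / exp_radius) ^ n) \<longlonglongrightarrow> 0"
    using assms(1) exp_radius_pos by (intro tendsto_mult_right_zero LIMSEQ_power_zero) simp
qed

lemma pabs_exp_term_le:
  "pabs (z ^ Suc n / fact (Suc n) :: 'a) \<le> pabs z * (pabs z / exp_radius) ^ n"
  using mult_left_mono[OF pabs_power_divide_fact_le[of z n] pabs_nonneg[of z]]
  by (simp add: pabs_mult pabs_divide del: fact_Suc)

lemma padic_exp_sums:
  assumes "pabs (z :: 'a) < exp_radius"
  shows "(\<lambda>n. z ^ n / fact n) sums padic_exp z"
proof -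
  have "(\<lambda>n. z ^ n / fact n) \<longlonglongrightarrow> 0"
    by (rule LIMSEQ_imp_Suc[OF tendsto_0_if_ratio_bound[OF assms pabs_exp_term_le]])
  then show ?thesis
    unfolding padic_exp_def by (intro summable_sums summable_if_tendsto_0)
qed

lemma pabs_exp_minus_partial_sum_le:
  assumes "pabs (z :: 'a) < exp_radius"
  shows "pabs (padic_exp z - (\<Sum>n<Suc m. z ^ n / fact n)) \<le> pabs z * (pabs z / exp_radius) ^ m"
proof (rule pabs_sums_minus_partial_sum_le[OF padic_exp_sums[OF assms]])
  fix n assume "n \<ge> Suc m"
  then obtain k where n_eq: "n = Suc k" "k \<ge> m"
    using Suc_le_D Suc_le_mono by blast
  have "(pabs z / exp_radius) ^ k \<le> (pabs z / exp_radius) ^ m"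
    using n_eq assms exp_radius_pos by (intro power_decreasing) auto
  then show "pabs (z ^ n / fact n) \<le> pabs z * (pabs z / exp_radius) ^ m"
    unfolding n_eq by (intro order_trans[OF pabs_exp_term_le] mult_left_mono) auto
qed

lemma pabs_exp_minus_1_le:
  assumes "pabs (z :: 'a) < exp_radius"
  shows "pabs (padic_exp z - 1) \<le> pabs z"
  using pabs_exp_minus_partial_sum_le[OF assms, of 0] by simp

lemma padic_exp_0 [simp]: "padic_exp (0 :: 'a) = 1"
  using pabs_exp_minus_1_le[of 0] exp_radius_pos by simp

lemma padic_exp_add:
  fixes a b :: 'a
  assumes a_small: "pabs a < exp_radius" and b_small: "pabs b < exp_radius"
  shows "padic_exp (a + b) = padic_exp a * padic_exp b"
proof -
  have "(a + b) ^ n / fact n = (\<Sum>i\<le>n. a ^ i / fact i * (b ^ (n - i) / fact (n - i)))" for n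
    unfolding binomial_ring sum_divide_distrib
    by (intro sum.cong) (auto simp: binomial_fact field_simps)
  then have "(\<lambda>n. (a + b) ^ n / fact n) sums (padic_exp a * padic_exp b)"
    using Cauchy_product_sums_ultrametric[OF padic_exp_sums[OF a_small] padic_exp_sums[OF b_small]]
    by simp
  then show ?thesis
    using padic_exp_sums[OF pabs_add_less[OF a_small b_small]] by (rule sums_unique2[symmetric])
qed

lemma padic_exp_of_nat_mult:
  assumes "pabs (z :: 'a) < exp_radius"
  shows "padic_exp (of_nat n * z) = padic_exp z ^ n"
  using assms by (induction n) (simp_all add: distrib_right padic_exp_add pabs_of_nat_mult_less)

lemma padic_exp_minus:
  assumes "pabs (z :: 'a) < exp_radius"
  shows "padic_exp (- z) = inverse (padic_exp z)"
  using padic_exp_add[of z "- z"] assms by (simp add: inverse_unique)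

definition exp_units :: "'a set" where
  "exp_units = {q. pabs (1 - q) < exp_radius}"

lemma exp_unit_diff_less: "q \<in> exp_units \<Longrightarrow> pabs (q - 1) < exp_radius"
  by (simp add: exp_units_def pabs_minus_commute)

lemma pabs_exp_unit: "q \<in> exp_units \<Longrightarrow> pabs q = 1"
  using pabs_eq_if_close[of q 1] exp_unit_diff_less[of q] exp_radius_less_1 by simp

lemma exp_unit_nonzero: "q \<in> exp_units \<Longrightarrow> q \<noteq> 0"
  using pabs_exp_unit by fastforce

lemma exp_units_1: "1 \<in> exp_units"
  using exp_radius_pos by (simp add: exp_units_def)

lemma exp_units_mult:
  assumes "a \<in> exp_units" "b \<in> exp_units"
  shows "a * b \<in> exp_units"
proof -
  have "pabs (a * (1 - b)) = pabs (1 - b)"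
    by (simp add: pabs_mult pabs_exp_unit[OF assms(1)])
  then have "pabs ((1 - a) + a * (1 - b)) < exp_radius"
    using assms by (intro pabs_add_less) (simp_all add: exp_units_def)
  then show ?thesis by (simp add: exp_units_def algebra_simps)
qed

lemma exp_units_power: "q \<in> exp_units \<Longrightarrow> q ^ n \<in> exp_units"
  by (induction n) (auto intro: exp_units_1 exp_units_mult)

lemma exp_units_inverse:
  assumes "q \<in> exp_units"
  shows "inverse q \<in> exp_units"
proof -
  have "1 - inverse q = (q - 1) / q"
    using exp_unit_nonzero[OF assms] by (simp add: field_simps)
  then show ?thesis
    using exp_unit_diff_less[OF assms] pabs_exp_unit[OF assms]
    by (simp add: exp_units_def pabs_divide)
qed

lemma padic_exp_in_exp_units: "pabs (z :: 'a) < exp_radius \<Longrightarrow> padic_exp z \<in> exp_units"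
  using pabs_exp_minus_1_le[of z] by (simp add: exp_units_def pabs_minus_commute)

lemma pabs_qnat:
  assumes "q \<in> exp_units"
  shows "pabs (qnat q n) = pabs (of_nat n :: 'a)"
proof (cases "n = 0")
  case False
  define t where "t = q - 1"
  have t_small: "pabs t < exp_radius"
    using exp_unit_diff_less[OF assms] by (simp add: t_def)
  let ?f = "\<lambda>k. of_nat ((n - 1) choose k) * t ^ k / of_nat (Suc k)"
  have term_le: "pabs (?f k) \<le> pabs t / exp_radius" if "k \<ge> 1" for k
  proof -
    have "pabs (?f k) \<le> pabs (t ^ k / of_nat (Suc k))"
      using pabs_mult_le[OF pabs_of_nat_le_1] by (simp only: times_divide_eq_right[symmetric])
    also have "\<dots> \<le> (pabs t / exp_radius) ^ k"
      by (rule pabs_power_divide_of_nat_le)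
    also have "\<dots> \<le> (pabs t / exp_radius) ^ 1"
      using that t_small exp_radius_pos by (intro power_decreasing) auto
    finally show ?thesis by simp
  qed
  have "sum ?f {..<n} - 1 = sum ?f {1..<n}"
    using False by (simp add: lessThan_atLeast0 sum.atLeast_Suc_lessThan)
  also have "pabs \<dots> \<le> pabs t / exp_radius"
    using term_le exp_radius_pos by (intro pabs_sum_le) auto
  also have "\<dots> < 1"
    using t_small exp_radius_pos by simp
  finally have "pabs (sum ?f {..<n}) = 1"
    using pabs_eq_if_close[of _ 1] by simp
  then show ?thesis
    by (simp add: qnat_eq_of_nat_times_sum[of q] pabs_mult t_def)
qed (simp add: qnat_0)

lemma qnat_nonzero: "q \<in> exp_units \<Longrightarrow> n > 0 \<Longrightarrow> qnat q n \<noteq> 0"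
  using pabs_qnat[of q n] by (metis less_irrefl of_nat_eq_0_iff pabs_eq_0_iff)

lemma pabs_power_diff:
  assumes a_unit: "a \<in> exp_units" and b_unit: "b \<in> exp_units"
  shows "pabs (a ^ n - b ^ n) = pabs (of_nat n :: 'a) * pabs (a - b)"
proof -
  define w where "w = a * inverse b"
  have a_eq: "a = w * b"
    using exp_unit_nonzero[OF b_unit] by (simp add: w_def)
  have "w \<in> exp_units"
    unfolding w_def by (intro exp_units_mult exp_units_inverse a_unit b_unit)
  then have "pabs (1 - w ^ n) = pabs (of_nat n :: 'a) * pabs (1 - w)"
    by (simp add: pabs_mult pabs_qnat flip: qnat_geometric)
  moreover have "a ^ n - b ^ n = - (1 - w ^ n) * b ^ n" "a - b = - (1 - w) * b"
    by (simp_all add: a_eq power_mult_distrib algebra_simps)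
  ultimately show ?thesis
    by (simp only: pabs_mult pabs_minus pabs_power pabs_exp_unit[OF b_unit]) simp
qed

lemma pabs_log_term_le:
  "pabs ((- 1) ^ n * z ^ Suc n / of_nat (Suc n) :: 'a) \<le> pabs z * (pabs z / exp_radius) ^ n"
  using mult_left_mono[OF pabs_power_divide_of_nat_le[of z n] pabs_nonneg[of z]]
  by (simp add: pabs_mult pabs_divide pabs_power del: of_nat_Suc)

lemma padic_log_sums:
  assumes "q \<in> exp_units"
  shows "(\<lambda>n. (- 1) ^ n * (q - 1) ^ Suc n / of_nat (Suc n)) sums padic_log q"
  unfolding padic_log_def
  by (intro summable_sums summable_if_tendsto_0
      tendsto_0_if_ratio_bound[OF exp_unit_diff_less[OF assms] pabs_log_term_le])

lemma pabs_log_less: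
  assumes "q \<in> exp_units"
  shows "pabs (padic_log q) < exp_radius"
proof -
  note diff_small = exp_unit_diff_less[OF assms]
  have "pabs ((- 1) ^ n * (q - 1) ^ Suc n / of_nat (Suc n)) \<le> pabs (q - 1) * 1" for n
    by (intro order_trans[OF pabs_log_term_le] mult_left_mono ratio_power_le_1 diff_small) simp
  then have "pabs (padic_log q) \<le> pabs (q - 1)"
    using pabs_sums_minus_partial_sum_le[OF padic_log_sums[OF assms], of 0] by simp
  with diff_small show ?thesis by simp
qed

lemma padic_log_1 [simp]: "padic_log (1 :: 'a) = 0"
  by (simp add: padic_log_def)

lemma pabs_binomial_minus_sign_le:
  assumes "M > 0"
  shows "pabs (of_nat ((M - 1) choose k) - (- 1) ^ k :: 'a) \<le> pabs (of_nat M / fact k :: 'a)"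
proof (induction k)
  case (Suc k)
  have "(of_nat M / fact k :: 'a) = of_nat (Suc k) * (of_nat M / fact (Suc k))"
    by (simp del: of_nat_Suc)
  then have "pabs (of_nat M / fact k :: 'a) \<le> pabs (of_nat M / fact (Suc k) :: 'a)"
    by (metis pabs_mult_le pabs_of_nat_le_1)
  with Suc.IH have previous_le: "pabs (of_nat ((M - 1) choose k) - (- 1) ^ k :: 'a)
      \<le> pabs (of_nat M / fact (Suc k) :: 'a)"
    by (rule order_trans)
  have "(of_nat (M choose Suc k) :: 'a) = of_nat ((M - 1) choose k) * (of_nat M / of_nat (Suc k))"
    by (simp add: of_nat_binomial_Suc mult.commute del: of_nat_Suc)
  then have "pabs (of_nat (M choose Suc k) :: 'a) \<le> pabs (of_nat M / of_nat (Suc k) :: 'a)"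
    by (metis pabs_mult_le pabs_of_nat_le_1)
  also have "\<dots> \<le> pabs (of_nat M / fact (Suc k) :: 'a)"
    by (rule pabs_divide_of_nat_le)
  finally have "pabs (of_nat (M choose Suc k) - (of_nat ((M - 1) choose k) - (- 1) ^ k) :: 'a)
      \<le> pabs (of_nat M / fact (Suc k) :: 'a)"
    using previous_le by (rule pabs_diff_le)
  moreover have "M choose Suc k = ((M - 1) choose k) + ((M - 1) choose Suc k)"
    using assms by (cases M) auto
  ultimately show ?case by (simp del: fact_Suc)
qed simp

text \<open>
  The coefficients of the power series in \<open>q - 1\<close> of \<open>(q ^ M - 1) / M\<close> and of \<open>log q\<close> are
  \<open>((M - 1) choose n) / (n + 1)\<close> and \<open>(-1) ^ n / (n + 1)\<close>.
\<close>

lemma pabs_power_minus_log_le: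
  assumes q_unit: "q \<in> exp_units" and "M > 0"
  shows "pabs (q ^ M - 1 - of_nat M * padic_log q) \<le> pabs (of_nat M :: 'a) ^ 2"
proof -
  define t where "t = q - 1"
  have t_small: "pabs t < exp_radius"
    using exp_unit_diff_less[OF q_unit] by (simp add: t_def)
  let ?g = "\<lambda>n. of_nat ((M - 1) choose n) * t ^ Suc n / of_nat (Suc n)"
  define s where "s = (\<Sum>n<M. ?g n)"
  have "q ^ M - 1 = t * qnat q M"
    using qnat_geometric[of q M] by (simp add: t_def algebra_simps)
  then have power_eq: "q ^ M - 1 = of_nat M * s"
    by (simp add: s_def qnat_eq_of_nat_times_sum[of q] t_def sum_distrib_left mult_ac
        del: of_nat_Suc)
  have terms_close: "pabs (?g n - (- 1) ^ n * t ^ Suc n / of_nat (Suc n)) \<le> pabs (of_nat M :: 'a)"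
    for n
  proof -
    have "?g n - (- 1) ^ n * t ^ Suc n / of_nat (Suc n)
        = (of_nat ((M - 1) choose n) - (- 1) ^ n) * (t ^ Suc n / of_nat (Suc n))"
      by (simp add: diff_divide_distrib left_diff_distrib del: of_nat_Suc power_Suc)
    also have "pabs \<dots> \<le> pabs (of_nat M / fact n :: 'a) * pabs (t ^ Suc n / of_nat (Suc n))"
      unfolding pabs_mult by (intro mult_right_mono pabs_binomial_minus_sign_le assms) auto
    also have "\<dots> = pabs (of_nat M :: 'a) * pabs (t ^ Suc n / fact (Suc n))"
      by (simp add: pabs_mult pabs_divide mult_ac del: of_nat_Suc power_Suc)
    also have "\<dots> \<le> pabs (of_nat M :: 'a) * (1 * 1)"
      using t_small exp_radius_pos exp_radius_less_1 ratio_power_le_1[OF t_small]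
      by (intro mult_left_mono order_trans[OF pabs_exp_term_le] mult_mono) auto
    finally show ?thesis by simp
  qed
  have "?g sums s"
    unfolding s_def using \<open>M > 0\<close> by (intro sums_finite) (auto simp: binomial_eq_0)
  from pabs_sums_diff_le[OF this padic_log_sums[OF q_unit, folded t_def] terms_close]
  have "pabs (s - padic_log q) \<le> pabs (of_nat M :: 'a)" .
  moreover have "q ^ M - 1 - of_nat M * padic_log q = of_nat M * (s - padic_log q)"
    by (simp add: power_eq right_diff_distrib)
  ultimately show ?thesis
    by (simp add: pabs_mult power2_eq_square mult_left_mono)
qed

lemma pabs_exp_power_minus_linear_le:
  assumes z_small: "pabs (z :: 'a) < exp_radius"
  shows "pabs (padic_exp z ^ M - 1 - of_nat M * z) \<le> pabs (of_nat M :: 'a) ^ 2"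
proof -
  define y where "y = of_nat M * z"
  have y_bounds: "pabs y < exp_radius" "pabs y \<le> pabs (of_nat M :: 'a)"
      "pabs y / exp_radius \<le> pabs (of_nat M :: 'a)"
    using z_small exp_radius_pos exp_radius_less_1 pabs_of_nat_mult_less[OF z_small, of M]
      mult_left_mono[of "pabs z" 1 "pabs (of_nat M :: 'a)"]
      mult_left_mono[of "pabs z" exp_radius "pabs (of_nat M :: 'a)"]
    by (auto simp: y_def pabs_mult divide_le_eq)
  have "pabs (padic_exp y - 1 - y) \<le> pabs y * (pabs y / exp_radius)"
    using pabs_exp_minus_partial_sum_le[OF y_bounds(1), of 1] by (simp add: diff_diff_eq)
  also have "\<dots> \<le> pabs (of_nat M :: 'a) * pabs (of_nat M :: 'a)"
    using y_bounds exp_radius_pos by (intro mult_mono) auto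
  finally show ?thesis
    by (simp add: y_def power2_eq_square padic_exp_of_nat_mult[OF z_small])
qed

lemma padic_exp_log:
  assumes q_unit: "q \<in> exp_units"
  shows "padic_exp (padic_log q) = q"
proof -
  let ?L = "padic_log q"
  note log_small = pabs_log_less[OF q_unit]
  have "pabs (padic_exp ?L - q) \<le> pabs (of_nat (p ^ N) :: 'a)" for N
  proof -
    define M where "M = p ^ N"
    have "M > 0" using p_gt_1 by (simp add: M_def)
    then have pabs_M_pos: "pabs (of_nat M :: 'a) > 0" by simp
    have "pabs (of_nat M :: 'a) * pabs (padic_exp ?L - q) = pabs (padic_exp ?L ^ M - q ^ M)"
      by (simp add: pabs_power_diff padic_exp_in_exp_units log_small q_unit)
    also have "\<dots> = pabs ((padic_exp ?L ^ M - 1 - of_nat M * ?L) - (q ^ M - 1 - of_nat M * ?L))"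
      by simp
    also have "\<dots> \<le> pabs (of_nat M :: 'a) ^ 2"
      using pabs_exp_power_minus_linear_le[OF log_small] pabs_power_minus_log_le[OF q_unit \<open>M > 0\<close>]
      by (rule pabs_diff_le)
    finally show ?thesis
      using pabs_M_pos unfolding M_def power2_eq_square by (rule mult_left_le_imp_le)
  qed
  then have "pabs (padic_exp ?L - q) \<le> 0"
    by (intro LIMSEQ_le_const[OF pabs_p_power_tendsto_0]) auto
  then show ?thesis by simp
qed

subsection \<open>\<open>p\<close>-adic powers and \<open>q\<close>-brackets\<close>

lemma padic_pow_minus_of_nat:
  assumes "q \<in> exp_units"
  shows "padic_pow q (- of_nat n) = inverse q ^ n"
  using pabs_log_less[OF assms]
  by (simp add: padic_pow_def padic_exp_minus pabs_of_nat_mult_less padic_exp_of_nat_mult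
      padic_exp_log[OF assms] power_inverse)

lemma padic_pow_add_of_nat:
  assumes "q \<in> exp_units" "pabs x \<le> 1"
  shows "padic_pow q (x + of_nat n) = padic_pow q x * q ^ n"
  using pabs_log_less[OF assms(1)] pabs_mult_le[OF assms(2), of "padic_log q"]
  by (simp add: padic_pow_def distrib_right padic_exp_add pabs_of_nat_mult_less
      padic_exp_of_nat_mult padic_exp_log[OF assms(1)])

lemma qbracket_1_add_of_nat:
  assumes "q \<in> exp_units" "pabs x \<le> 1"
  shows "qbracket q 1 (x + of_nat n) = qbracket q 1 x + padic_pow q x * qnat q n"
proof (cases "q = 1")
  case True
  then show ?thesis by (simp add: qbracket_def qnat_base_1 padic_pow_def)
next
  case False
  then have "qnat q n = (1 - q ^ n) / (1 - q)"
    by (simp add: eq_divide_eq mult.commute flip: qnat_geometric)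
  then show ?thesis
    using False
    by (simp add: qbracket_def padic_pow_add_of_nat[OF assms] right_diff_distrib
        flip: add_divide_distrib)
qed

lemma qbracket_1_of_nat:
  assumes "q \<in> exp_units"
  shows "qbracket q 1 (of_nat n) = qnat q n"
  using qbracket_1_add_of_nat[OF assms, of 0 n] by (simp add: qbracket_def padic_pow_def)

lemma qbracket_rescale:
  assumes "q \<in> exp_units" "l > 0"
  shows "qbracket q l z = qbracket q 1 (of_nat l * z) / qnat q l"
proof (cases "q = 1")
  case True
  then show ?thesis using assms by (simp add: qbracket_def qnat_base_1)
next
  case False
  then have "q ^ l \<noteq> 1"
    using qnat_geometric[of q l] qnat_nonzero[OF assms] by auto
  then show ?thesis
    using False by (simp add: qbracket_def flip: qnat_geometric)
qed

subsection \<open>Continuity along powers of \<open>p\<close>\<close>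

text \<open>
  A weak form of continuity for the \<open>p\<close>-adic topology on the natural numbers: only the increments along
  which the fermionic integral takes its limit are tested.
\<close>

definition prime_power_continuous :: "(nat \<Rightarrow> 'a) \<Rightarrow> bool" where
  "prime_power_continuous f \<longleftrightarrow> (\<forall>n d. (\<lambda>N. f (n + d * p ^ N)) \<longlonglongrightarrow> f n)"

lemma prime_power_continuous_const: "prime_power_continuous (\<lambda>_. c)"
  by (simp add: prime_power_continuous_def)

lemma prime_power_continuous_add:
  "prime_power_continuous f \<Longrightarrow> prime_power_continuous g \<Longrightarrow> prime_power_continuous (\<lambda>n. f n + g n)"
  by (simp add: prime_power_continuous_def ultrametric_tendsto_add)

lemma prime_power_continuous_mult:
  "prime_power_continuous f \<Longrightarrow> prime_power_continuous g \<Longrightarrow> prime_power_continuous (\<lambda>n. f n * g n)"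
  by (simp add: prime_power_continuous_def ultrametric_tendsto_mult)

lemma prime_power_continuous_sum:
  "(\<And>i. i \<in> A \<Longrightarrow> prime_power_continuous (f i)) \<Longrightarrow> prime_power_continuous (\<lambda>n. \<Sum>i\<in>A. f i n)"
  by (induction A rule: infinite_finite_induct)
    (simp_all add: prime_power_continuous_const prime_power_continuous_add)

lemma prime_power_continuous_poly:
  "prime_power_continuous f \<Longrightarrow> prime_power_continuous (\<lambda>n. poly P (f n))"
  by (induction P)
    (simp_all add: prime_power_continuous_const prime_power_continuous_add
      prime_power_continuous_mult)

lemma prime_power_continuous_affine:
  assumes "prime_power_continuous f"
  shows "prime_power_continuous (\<lambda>t. f (a + b * t))"
  unfolding prime_power_continuous_def
proof (intro allI)
  fix n d
  have "(\<lambda>N. f ((a + b * n) + (b * d) * p ^ N)) \<longlonglongrightarrow> f (a + b * n)"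
    using assms unfolding prime_power_continuous_def by blast
  then show "(\<lambda>N. f (a + b * (n + d * p ^ N))) \<longlonglongrightarrow> f (a + b * n)"
    by (simp add: algebra_simps)
qed

lemma prime_power_continuous_shift:
  "prime_power_continuous f \<Longrightarrow> prime_power_continuous (\<lambda>n. f (n + s))"
  using prime_power_continuous_affine[of f s 1] by (simp add: add.commute)

lemma prime_power_continuous_twisted_shift_sum:
  "prime_power_continuous f \<Longrightarrow> prime_power_continuous (twisted_shift_sum u l k f)"
  unfolding twisted_shift_sum_def[abs_def]
  by (intro prime_power_continuous_sum prime_power_continuous_mult prime_power_continuous_const
      prime_power_continuous_shift)

lemma prime_power_continuous_qnat:
  assumes "q \<in> exp_units"
  shows "prime_power_continuous (qnat q)"
  unfolding prime_power_continuous_def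
proof (intro allI tendsto_if_pabs_le)
  show "pabs (qnat q (n + d * p ^ N) - qnat q n) \<le> pabs (of_nat (p ^ N) :: 'a)" for n d N
    using pabs_mult_le[OF pabs_of_nat_le_1, of d "of_nat (p ^ N)"]
    by (simp add: qnat_add pabs_mult pabs_power pabs_exp_unit[OF assms] pabs_qnat[OF assms])
qed (rule pabs_p_power_tendsto_0)

lemma prime_power_continuous_power:
  assumes "q \<in> exp_units"
  shows "prime_power_continuous (\<lambda>n. q ^ n)"
proof -
  have "prime_power_continuous (\<lambda>n. poly [:1, q - 1:] (qnat q n))"
    by (intro prime_power_continuous_poly prime_power_continuous_qnat assms)
  moreover have "poly [:1, q - 1:] (qnat q n) = q ^ n" for n
    using qnat_geometric[of q n] by (simp add: algebra_simps)
  ultimately show ?thesis by simp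
qed

end

subsection \<open>Fermionic integrals\<close>

locale odd_padic_field = padic_field ty p
  for ty :: "'a::{field_char_0, complete_space} itself" and p +
  assumes odd_p: "odd p"
begin

lemma pabs_one_plus_exp_unit:
  assumes "q \<in> exp_units"
  shows "pabs (1 + q) = 1"
proof -
  have "\<not> p dvd 2"
    using odd_p p_gt_1 dvd_imp_le[of p 2] by (cases "p = 2") auto
  then have "pabs (2 :: 'a) = 1"
    using pabs_of_nat_not_dvd[of 2] by simp
  moreover have "pabs ((1 + q) - 2) < 1"
    using assms exp_radius_less_1 by (simp add: exp_units_def pabs_minus_commute)
  ultimately show ?thesis
    using pabs_eq_if_close[of "1 + q" 2] by simp
qed

lemma one_plus_exp_unit_nonzero: "q \<in> exp_units \<Longrightarrow> 1 + q \<noteq> 0"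
  using pabs_one_plus_exp_unit by fastforce

lemma fermionic_integral_eqI:
  fixes f :: "'a \<Rightarrow> 'a" and g :: "nat \<Rightarrow> 'a"
  assumes Q_unit: "Q \<in> exp_units" and continuous: "prime_power_continuous g"
    and functional_equation: "\<And>x. (1 + Q) * f (of_nat x) = g x + Q * g (Suc x)"
  shows "fermionic_integral p Q f = g 0"
proof -
  let ?X = "\<lambda>N. (1 + Q) / (1 + Q ^ (p ^ N)) * (\<Sum>x<p ^ N. f (of_nat x) * (- 1) ^ x * Q ^ x)"
  have error_eq: "pabs (?X N - g 0) = pabs (g (p ^ N) - g 0)" for N
  proof -
    define M where "M = p ^ N"
    have "odd M" using odd_p by (simp add: M_def)
    have power_unit: "Q ^ M \<in> exp_units" by (rule exp_units_power[OF Q_unit])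
    have "(1 + Q) * (\<Sum>x<M. f (of_nat x) * (- 1) ^ x * Q ^ x)
        = (\<Sum>x<M. (- Q) ^ x * ((1 + Q) * f (of_nat x)))"
      by (simp add: sum_distrib_left power_minus[of Q] mult_ac)
    also have "\<dots> = (\<Sum>x<M. (- Q) ^ x * g x - (- Q) ^ Suc x * g (Suc x))"
      unfolding functional_equation by (simp add: algebra_simps)
    also have "\<dots> = g 0 + Q ^ M * g M"
      using \<open>odd M\<close> by (subst sum_lessThan_telescope') simp
    finally have "?X N - g 0 = (g 0 + Q ^ M * g M) / (1 + Q ^ M) - g 0"
      by (simp add: M_def)
    also have "\<dots> = Q ^ M * (g M - g 0) / (1 + Q ^ M)"
      using one_plus_exp_unit_nonzero[OF power_unit] by (simp add: divide_diff_eq_iff algebra_simps)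
    finally show ?thesis
      using pabs_exp_unit[OF power_unit] pabs_one_plus_exp_unit[OF power_unit]
      by (simp add: pabs_divide pabs_mult M_def)
  qed
  have "(\<lambda>N. g (0 + 1 * p ^ N)) \<longlonglongrightarrow> g 0"
    using continuous unfolding prime_power_continuous_def by blast
  then have "?X \<longlonglongrightarrow> g 0"
    unfolding tendsto_iff_pabs error_eq by simp
  then show ?thesis
    unfolding fermionic_integral_def by (rule limI)
qed

definition fermionic_tower :: "'a \<Rightarrow> nat \<Rightarrow> (nat \<Rightarrow> nat \<Rightarrow> 'a) \<Rightarrow> bool" where
  "fermionic_tower Q l \<psi> \<longleftrightarrow>
     (\<forall>k. prime_power_continuous (\<psi> k)) \<and>
     (\<forall>k n. \<psi> (Suc k) n + inverse Q ^ k * \<psi> (Suc k) (n + l) = (1 + Q) * \<psi> k n)"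

lemma fermionic_tower_continuous: "fermionic_tower Q l \<psi> \<Longrightarrow> prime_power_continuous (\<psi> k)"
  by (simp add: fermionic_tower_def)

lemma fermionic_tower_equation:
  "fermionic_tower Q l \<psi> \<Longrightarrow>
     \<psi> (Suc k) n + inverse Q ^ k * \<psi> (Suc k) (n + l) = (1 + Q) * \<psi> k n"
  by (simp add: fermionic_tower_def)

lemma fermionic_integral_tower:
  assumes Q_unit: "Q \<in> exp_units" and tower: "fermionic_tower Q l \<psi>"
    and f_eq: "\<And>t. f (of_nat t) = c * inverse Q ^ (Suc k * t) * \<psi> k (n + l * t)"
  shows "fermionic_integral p Q f = c * \<psi> (Suc k) n"
proof -
  let ?u = "inverse Q ^ Suc k"
  define g where "g t = c * (?u ^ t * \<psi> (Suc k) (n + l * t))" for t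
  have "prime_power_continuous g"
    unfolding g_def[abs_def]
    by (intro prime_power_continuous_mult prime_power_continuous_const prime_power_continuous_affine
        prime_power_continuous_power exp_units_power exp_units_inverse Q_unit
        fermionic_tower_continuous[OF tower])
  moreover have "(1 + Q) * f (of_nat t) = g t + Q * g (Suc t)" for t
  proof -
    have "(1 + Q) * f (of_nat t) = c * ?u ^ t * ((1 + Q) * \<psi> k (n + l * t))"
      unfolding f_eq power_mult by (simp only: mult_ac)
    also have "(1 + Q) * \<psi> k (n + l * t) =
        \<psi> (Suc k) (n + l * t) + inverse Q ^ k * \<psi> (Suc k) (n + l * Suc t)"
      using fermionic_tower_equation[OF tower, of k "n + l * t"] by (simp add: add_ac)
    also have "inverse Q ^ k = Q * ?u"
      using exp_unit_nonzero[OF Q_unit] by simp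
    finally show ?thesis
      unfolding g_def power_Suc[of ?u t] by (simp only: algebra_simps)
  qed
  ultimately have "fermionic_integral p Q f = g 0"
    by (intro fermionic_integral_eqI Q_unit)
  then show ?thesis by (simp add: g_def)
qed

lemma iterated_fermionic_integral_tower:
  fixes F :: "(nat \<Rightarrow> 'a) \<Rightarrow> 'a"
  assumes Q_unit: "Q \<in> exp_units" and tower: "fermionic_tower Q l \<psi>"
    and "\<And>v. F (\<lambda>j. of_nat (v j)) =
      c * inverse Q ^ (\<Sum>j=1..k. j * v j) * \<psi> 0 (n + l * (\<Sum>j=1..k. v j))"
  shows "iterated_fermionic_integral p Q k F = c * \<psi> k n"
  using assms(3)
proof (induction k arbitrary: F c n)
  case 0
  then show ?case using "0"[of "\<lambda>_. 0"] by simp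
next
  case (Suc k)
  have "iterated_fermionic_integral p Q k (\<lambda>x. F (x(Suc k := of_nat t)))
      = c * inverse Q ^ (Suc k * t) * \<psi> k (n + l * t)" for t
  proof (rule Suc.IH)
    fix v :: "nat \<Rightarrow> nat"
    have "(\<lambda>j. of_nat (v j) :: 'a)(Suc k := of_nat t) = (\<lambda>j. of_nat ((v(Suc k := t)) j))"
      by auto
    then show "F ((\<lambda>j. of_nat (v j))(Suc k := of_nat t)) = c * inverse Q ^ (Suc k * t)
        * inverse Q ^ (\<Sum>j=1..k. j * v j) * \<psi> 0 (n + l * t + l * (\<Sum>j=1..k. v j))"
      by (simp only: Suc.prems sum_mult_fun_upd_Suc sum_fun_upd_Suc power_add distrib_left
          mult_ac add_ac)
  qed
  then show ?case
    unfolding iterated_fermionic_integral.simps by (intro fermionic_integral_tower[OF Q_unit tower])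
qed

lemma exists_fermionic_tower:
  assumes q_unit: "q \<in> exp_units"
  obtains \<psi> where "fermionic_tower (q ^ l) l \<psi>" "\<And>n. \<psi> 0 n = poly P\<^sub>0 (qnat q n)"
proof -
  have "1 + inverse (q ^ l) ^ k * (q ^ l) ^ r \<noteq> 0" for k r
    by (intro one_plus_exp_unit_nonzero exp_units_mult exp_units_power exp_units_inverse q_unit)
  then have "\<exists>P. P + smult (inverse (q ^ l) ^ k) (pcompose P [:qnat q l, q ^ l:])
      = smult (1 + q ^ l) R"
    for k R
    by (rule exists_poly_affine_functional_equation)
  then obtain G where G_solves:
    "G k R + smult (inverse (q ^ l) ^ k) (pcompose (G k R) [:qnat q l, q ^ l:])
      = smult (1 + q ^ l) R" for k R
    by metis
  define P where "P = rec_nat P\<^sub>0 G"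
  have "poly (P (Suc k)) (qnat q n) + inverse (q ^ l) ^ k * poly (P (Suc k)) (qnat q (n + l))
      = (1 + q ^ l) * poly (P k) (qnat q n)" for k n
    using arg_cong[OF G_solves[of k "P k"], of "\<lambda>R. poly R (qnat q n)"]
    by (simp add: P_def poly_pcompose add.commute[of n l] qnat_add mult.commute)
  then have "fermionic_tower (q ^ l) l (\<lambda>k n. poly (P k) (qnat q n))"
    unfolding fermionic_tower_def
    by (auto intro: prime_power_continuous_poly prime_power_continuous_qnat q_unit)
  then show ?thesis
    by (rule that) (simp add: P_def)
qed

lemma fermionic_tower_twisted_shift_sum:
  assumes q_unit: "q \<in> exp_units" and odd_l: "odd l" and tower: "fermionic_tower (q ^ l) l \<psi>"
  shows "fermionic_tower q 1
    (\<lambda>k n. ((1 + q) / (1 + q ^ l)) ^ k * twisted_shift_sum (inverse q) l k (\<psi> k) n)"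
proof -
  define c where "c = (1 + q) / (1 + q ^ l)"
  let ?\<phi> = "\<lambda>k n. c ^ k * twisted_shift_sum (inverse q) l k (\<psi> k) n"
  have c_mult: "c * (1 + q ^ l) = 1 + q"
    using one_plus_exp_unit_nonzero[OF exp_units_power[OF q_unit]] by (simp add: c_def)
  have "prime_power_continuous (?\<phi> k)" for k
    by (intro prime_power_continuous_mult prime_power_continuous_const
        prime_power_continuous_twisted_shift_sum fermionic_tower_continuous[OF tower])
  moreover have "?\<phi> (Suc k) n + inverse q ^ k * ?\<phi> (Suc k) (n + 1) = (1 + q) * ?\<phi> k n" for k n
  proof -
    let ?S = "twisted_shift_sum (inverse q) l"
    have "\<psi> (Suc k) n + (inverse q ^ l) ^ k * \<psi> (Suc k) (n + l) = (1 + q ^ l) * \<psi> k n" for n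
      using fermionic_tower_equation[OF tower] by (simp add: power_inverse)
    then have "?S (Suc k) (\<psi> (Suc k)) n + inverse q ^ k * ?S (Suc k) (\<psi> (Suc k)) (n + 1)
        = (1 + q ^ l) * ?S k (\<psi> k) n"
      by (rule twisted_shift_sum_telescope[OF odd_l])
    then have "?\<phi> (Suc k) n + inverse q ^ k * ?\<phi> (Suc k) (n + 1)
        = c ^ Suc k * ((1 + q ^ l) * ?S k (\<psi> k) n)"
      by (metis distrib_left mult.left_commute)
    also have "\<dots> = (c * (1 + q ^ l)) * ?\<phi> k n"
      by (simp add: mult_ac)
    finally show ?thesis unfolding c_mult .
  qed
  ultimately show ?thesis
    by (simp add: fermionic_tower_def flip: c_def)
qed

subsection \<open>The distribution relation\<close>

lemma qEuler_eq_tower: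
  assumes q_unit: "q \<in> exp_units" and l_pos: "l > 0" and tower: "fermionic_tower (q ^ l) l \<psi>"
    and tower_0: "\<And>n. \<psi> 0 n = qbracket q 1 (x + of_nat n) ^ m"
  shows "qEuler p q l m k ((x + of_nat n) / of_nat l) = \<psi> k n / qnat q l ^ m"
proof -
  note Q_unit = exp_units_power[OF q_unit, of l]
  have "qEuler p q l m k ((x + of_nat n) / of_nat l) = (1 / qnat q l ^ m) * \<psi> k n"
    unfolding qEuler_def
  proof (rule iterated_fermionic_integral_tower[OF Q_unit tower])
    fix v :: "nat \<Rightarrow> nat"
    let ?s = "\<Sum>j=1..k. v j" and ?w = "\<Sum>j=1..k. j * v j"
    have "of_nat l * ((x + of_nat n) / of_nat l + of_nat ?s) = x + of_nat (n + l * ?s)"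
      using l_pos by (subst distrib_left) simp
    then have bracket_eq: "qbracket q l ((x + of_nat n) / of_nat l + of_nat ?s) ^ m
        = 1 / qnat q l ^ m * \<psi> 0 (n + l * ?s)"
      unfolding qbracket_rescale[OF q_unit l_pos] tower_0 by (simp add: power_divide)
    have "(\<Sum>j=1..k. of_nat (v j)) = (of_nat ?s :: 'a)"
      "(\<Sum>j=1..k. of_nat j * of_nat (v j)) = (of_nat ?w :: 'a)"
      by simp_all
    then show "qbracket q l ((x + of_nat n) / of_nat l + (\<Sum>j=1..k. of_nat (v j))) ^ m
        * padic_pow (q ^ l) (- (\<Sum>j=1..k. of_nat j * of_nat (v j)))
      = 1 / qnat q l ^ m * inverse (q ^ l) ^ ?w * \<psi> 0 (n + l * ?s)"
      by (simp only: bracket_eq padic_pow_minus_of_nat[OF Q_unit] mult_ac)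
  qed
  then show ?thesis by simp
qed

lemma qEuler_distribution:
  assumes q_unit: "q \<in> exp_units" and pabs_x_le_1: "pabs x \<le> 1" and odd_l: "odd l"
  shows "qEuler p q 1 m k x =
    qbracket q 1 (of_nat l) ^ m / qbracket_minus q l ^ k *
    (\<Sum>i \<in> {1..k} \<rightarrow>\<^sub>E {0..<l}.
       q powi (- int (\<Sum>j=2..k. (j - 1) * i j)) * (- 1) ^ (\<Sum>j=1..k. i j) *
       qEuler p q l m k ((x + of_nat (\<Sum>j=1..k. i j)) / of_nat l))"
proof -
  have "l > 0" using odd_l by (cases l) auto
  obtain \<psi> where tower: "fermionic_tower (q ^ l) l \<psi>"
    and "\<And>n. \<psi> 0 n = poly ([:qbracket q 1 x, padic_pow q x:] ^ m) (qnat q n)"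
    using exists_fermionic_tower[OF q_unit] by blast
  then have tower_0: "\<psi> 0 n = qbracket q 1 (x + of_nat n) ^ m" for n
    unfolding qbracket_1_add_of_nat[OF q_unit pabs_x_le_1] by (simp add: mult.commute)
  let ?S = "twisted_shift_sum (inverse q) l k" and ?c = "(1 + q) / (1 + q ^ l)"
  have "qEuler p q 1 m k ((x + of_nat 0) / of_nat 1) = ?c ^ k * ?S (\<psi> k) 0 / qnat q 1 ^ m"
    using fermionic_tower_twisted_shift_sum[OF q_unit odd_l tower]
    by (intro qEuler_eq_tower q_unit) (simp_all add: twisted_shift_sum_0 tower_0)
  then have "qEuler p q 1 m k x = ?c ^ k * ?S (\<psi> k) 0"
    by (simp only: qnat_1) simp
  also have "\<psi> k = (\<lambda>n. qnat q l ^ m * qEuler p q l m k ((x + of_nat n) / of_nat l))"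
    using qnat_nonzero[OF q_unit \<open>l > 0\<close>]
    by (simp add: qEuler_eq_tower[OF q_unit \<open>l > 0\<close> tower tower_0])
  also have "?c = 1 / qbracket_minus q l"
    using odd_l by (simp add: qbracket_minus_def)
  finally show ?thesis
    unfolding twisted_shift_sum_mult twisted_shift_sum_def twist_inverse
      qbracket_1_of_nat[OF q_unit] power_one_over
    by simp
qed

end

theorem theorem3:
  fixes p l k m :: nat
    and q x :: "'a::{field_char_0, complete_space}"
  assumes "is_padic_complex p TYPE('a)"
    and "odd p"
    and "pabs (1 - q) < real p powr (- 1 / (real p - 1))"
    and "odd l"
    and "k \<ge> 1"
    and "x \<in> padic_ints"
  shows "(qEuler p q 1 m k x =
           qbracket q 1 (of_nat l) ^ m / qbracket_minus q l ^ k *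
           (\<Sum>i \<in> {1..k} \<rightarrow>\<^sub>E {0..<l}.
              q powi (- int (\<Sum>j=2..k. (j - 1) * i j)) * (- 1) ^ (\<Sum>j=1..k. i j) *
              qEuler p q l m k ((x + of_nat (\<Sum>j=1..k. i j)) / of_nat l))) \<and>
         (qEuler p q 1 m k (of_nat l * x) =
           qbracket q 1 (of_nat l) ^ m / qbracket_minus q l ^ k *
           (\<Sum>i \<in> {1..k} \<rightarrow>\<^sub>E {0..<l}.
              q powi (- int (\<Sum>j=2..k. (j - 1) * i j)) * (- 1) ^ (\<Sum>j=1..k. i j) *
              qEuler p q l m k (x + of_nat (\<Sum>j=1..k. i j) / of_nat l)))"
proof -
  interpret odd_padic_field "TYPE('a)" p
    using assms by unfold_locales (auto simp: is_padic_complex_def)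
  have q_unit: "q \<in> exp_units"
    using assms by (simp add: exp_units_def exp_radius_def)
  have pabs_x_le_1: "pabs x \<le> 1"
    using assms by (simp add: padic_ints_def)
  then have pabs_lx_le_1: "pabs (of_nat l * x) \<le> 1"
    by (simp add: pabs_mult mult_le_one)
  have "l \<noteq> 0" using assms by (cases l) auto
  then have rescale: "x + of_nat s / of_nat l = (of_nat l * x + of_nat s) / of_nat l" for s
    by (simp add: add_divide_distrib)
  show ?thesis
    unfolding rescale
    using qEuler_distribution[OF q_unit pabs_x_le_1 \<open>odd l\<close>]
      qEuler_distribution[OF q_unit pabs_lx_le_1 \<open>odd l\<close>] by blast
qed

end
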